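(* Let $s,t,k,m$ be nonnegative integers. There is a bijection $\varphi$ between the set of pairs of partitions $(\alpha,\beta)$, where $\alpha$ has $s$ distinct parts with each part $\ge m$ and $\beta$ has $t$ parts with each part $\ge k+s+t-1$, and the set of pairs of partitions $(\mu,\nu)$ satisfying the following: if $s,t>0$, then $\mu$ has $s+t$ distinct nonnegative parts with $\mu_s-\mu_{s+1}\ge m+1$ and $\nu$ has $t$ distinct parts with $k\le \nu_i\le k+s+t-1$ for each $1\le i\le t$; if $s>0$ and $t=0$, then $\mu=\alpha$ and $\nu$ is the empty partition; if $s=0$ and $t>0$, then $\mu=(\beta_1-k,\beta_2-k-1,\ldots,\beta_t-k-t+1)$ and $\nu=(k+t-1,k+t-2,\ldots,k)$; if $s=t=0$, then both $\mu$ and $\nu$ are empty partitions. Moreover, the bijection satisfies $|\alpha|+|\beta|=|\mu|+|\nu|$.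
   Context: A partition $\lambda=(\lambda_1,\ldots,\lambda_r)$ has $\lambda_1\ge\lambda_2\ge\cdots\ge\lambda_r\ge 0$; $l(\lambda)$ is its number of parts and $|\lambda|$ the sum of its parts. This is a variation of Zeilberger's Algorithm Z (insertion of the parts of one partition into another, with a record partition keeping track of insertion positions); $\mu$ is called the insertion partition and $\nu$ the record partition. *)

theory Defs
  imports Main
begin

text \<open>
  A partition is the weakly decreasing list of its parts. Since the convention is
  \<open>\<lambda>\<^sub>r \<ge> 0\<close>, parts equal to 0 are allowed and are counted in the number of parts:
  \<open>l(\<lambda>) = length \<lambda>\<close> and \<open>|\<lambda>| = sum_list \<lambda>\<close>. The list entry \<open>\<lambda> ! i\<close> is the part \<open>\<lambda>\<^bsub>i+1\<^esub>\<close>.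
\<close>

definition is_partition :: "nat list \<Rightarrow> bool" where
  "is_partition xs \<longleftrightarrow> sorted_wrt (\<ge>) xs"

text \<open>
  The truncated subtraction in \<open>k + s + t - 1\<close> is harmless, here and below: the bound is
  only imposed on parts of a partition with \<open>t\<close> parts, so \<open>t \<ge> 1\<close> whenever it matters.
\<close>

definition source_pairs :: "nat \<Rightarrow> nat \<Rightarrow> nat \<Rightarrow> nat \<Rightarrow> (nat list \<times> nat list) set" where
  "source_pairs s t k m = {(\<alpha>, \<beta>).
     is_partition \<alpha> \<and> length \<alpha> = s \<and> distinct \<alpha> \<and> (\<forall>a\<in>set \<alpha>. m \<le> a) \<and>
     is_partition \<beta> \<and> length \<beta> = t \<and> (\<forall>b\<in>set \<beta>. k + s + t - 1 \<le> b)}"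

text \<open>
  The pair \<open>(\<mu>, \<nu>)\<close> prescribed for \<open>(\<alpha>, \<beta>)\<close> when \<open>s = 0\<close> or \<open>t = 0\<close>. In the second branch
  \<open>i\<close> starts at 0, so the entries are \<open>\<beta>\<^bsub>i+1\<^esub> - k - i\<close> and \<open>k + t - 1 - i\<close>; for \<open>s = 0\<close> the
  parts of \<open>\<beta>\<close> are at least \<open>k + t - 1\<close>, so no subtraction truncates.
\<close>

definition degenerate_map ::
  "nat \<Rightarrow> nat \<Rightarrow> nat \<Rightarrow> nat list \<times> nat list \<Rightarrow> nat list \<times> nat list" where
  "degenerate_map s t k = (\<lambda>(\<alpha>, \<beta>).
     if s > 0 \<and> t = 0 then (\<alpha>, [])
     else if s = 0 \<and> t > 0 then
       (map (\<lambda>i. \<beta> ! i - k - i) [0..<t], map (\<lambda>i. k + t - 1 - i) [0..<t])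
     else ([], []))"

text \<open>
  The condition \<open>\<mu>\<^sub>s - \<mu>\<^bsub>s+1\<^esub> \<ge> m + 1\<close> is stated additively. In the degenerate cases the
  set consists of the prescribed pairs.
\<close>

definition target_pairs :: "nat \<Rightarrow> nat \<Rightarrow> nat \<Rightarrow> nat \<Rightarrow> (nat list \<times> nat list) set" where
  "target_pairs s t k m = {(\<mu>, \<nu>).
     is_partition \<mu> \<and> is_partition \<nu> \<and>
     (if s > 0 \<and> t > 0 then
        length \<mu> = s + t \<and> distinct \<mu> \<and> \<mu> ! (s - 1) \<ge> \<mu> ! s + (m + 1) \<and>
        length \<nu> = t \<and> distinct \<nu> \<and> (\<forall>x\<in>set \<nu>. k \<le> x \<and> x \<le> k + s + t - 1)
      else (\<mu>, \<nu>) \<in> degenerate_map s t k ` source_pairs s t k m)}"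

end

theory Submission
  imports Defs
begin

text \<open>
  The inverse bijection has a closed form. After normalising to \<open>m = 0\<close> (subtract \<open>m\<close> from
  every part of \<open>\<alpha>\<close> and from the first \<open>s\<close> parts of \<open>\<mu>\<close>), index the entries of \<open>\<mu>\<close> by
  \<open>k, k + 1, \<dots>, k + s + t - 1\<close>; the parts of \<open>\<beta>\<close> are \<open>x + j\<close> for the entries \<open>x\<close> whose index \<open>j\<close>
  lies in \<open>\<nu>\<close>, and \<open>\<alpha>\<close> consists of the other entries. Strict decrease of \<open>\<mu>\<close> makes \<open>x + j\<close> weakly
  decreasing in \<open>j\<close>. Conversely, the parts of \<open>\<beta>\<close> are inserted in decreasing order: \<open>b\<close> is inserted
  as \<open>b - j\<close> at the least index \<open>j\<close> where it exceeds the next part of \<open>\<alpha>\<close>, and \<open>j\<close> is recorded.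
\<close>

section \<open>Insertion and extraction for pairs normalised to \<open>m = 0\<close>\<close>

fun zmerge :: "nat \<Rightarrow> nat list \<Rightarrow> nat list \<Rightarrow> nat list \<times> nat list" where
  "zmerge p \<alpha> [] = (\<alpha>, [])"
| "zmerge p [] (b # \<beta>) = (case zmerge (Suc p) [] \<beta> of (\<mu>, js) \<Rightarrow> ((b - p) # \<mu>, p # js))"
| "zmerge p (a # \<alpha>) (b # \<beta>) =
    (if a + p < b then (case zmerge (Suc p) (a # \<alpha>) \<beta> of (\<mu>, js) \<Rightarrow> ((b - p) # \<mu>, p # js))
     else (case zmerge (Suc p) \<alpha> (b # \<beta>) of (\<mu>, js) \<Rightarrow> (a # \<mu>, js)))"

text \<open>The second clause is a default value: on \<open>ztarget\<close> the indices in
  \<open>js\<close> point into \<open>\<mu>\<close>, so the entries never run out before the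
  indices.\<close>

fun zsplit :: "nat \<Rightarrow> nat list \<Rightarrow> nat list \<Rightarrow> nat list \<times> nat list" where
  "zsplit p \<mu> [] = (\<mu>, [])"
| "zsplit p [] (j # js) = ([], [])"
| "zsplit p (x # \<mu>) (j # js) =
    (if j = p then (case zsplit (Suc p) \<mu> js of (\<alpha>, \<beta>) \<Rightarrow> (\<alpha>, (x + p) # \<beta>))
     else (case zsplit (Suc p) \<mu> (j # js) of (\<alpha>, \<beta>) \<Rightarrow> (x # \<alpha>, \<beta>)))"

text \<open>The bound is stated with \<open>Suc b\<close> to avoid truncated subtraction. Each
  recursive step raises \<open>p\<close> and shortens one of the two lists, so
  \<open>p + s + t\<close> stays constant and the bound passes unchanged to the recursive
  call.\<close>

definition zsource :: "nat \<Rightarrow> nat \<Rightarrow> nat \<Rightarrow> (nat list \<times> nat list) set" where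
  "zsource p s t = {(\<alpha>, \<beta>). sorted_wrt (>) \<alpha> \<and> length \<alpha> = s \<and>
     sorted_wrt (\<ge>) \<beta> \<and> length \<beta> = t \<and> (\<forall>b\<in>set \<beta>. p + s + t \<le> Suc b)}"

text \<open>The indices stand in the increasing order in which the recursion records them;
  \<open>rev\<close> later turns them into the record partition \<open>\<nu>\<close>.\<close>

definition ztarget :: "nat \<Rightarrow> nat \<Rightarrow> nat \<Rightarrow> (nat list \<times> nat list) set" where
  "ztarget p s t = {(\<mu>, js). sorted_wrt (>) \<mu> \<and> length \<mu> = s + t \<and>
     sorted_wrt (<) js \<and> length js = t \<and> (\<forall>j\<in>set js. p \<le> j \<and> j < p + s + t)}"

text \<open>An entry not taken from \<open>\<alpha>\<close> is \<open>b - j\<close> with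
  \<open>j \<ge> p\<close>, and the bound on \<open>\<beta>\<close> forces \<open>j \<le> b\<close>,
  so the subtraction is exact. Applied at \<open>Suc p\<close>, this shows that the first entry of a
  merge exceeds the later ones.\<close>

lemma zmerge_mem_bound:
  assumes "zmerge p \<alpha> \<beta> = (\<mu>, js)" "\<forall>b\<in>set \<beta>. p + length \<alpha> + length \<beta> \<le> Suc b" "x \<in> set \<mu>"
  shows "x \<in> set \<alpha> \<or> (\<exists>b\<in>set \<beta>. x + p \<le> b)"
  using assms
proof (induction p \<alpha> \<beta> arbitrary: \<mu> js rule: zmerge.induct)
  case (1 p \<alpha>)
  then show ?case by simp
next
  case (2 p b \<beta>)
  obtain \<mu>' js' where z: "zmerge (Suc p) [] \<beta> = (\<mu>', js')" by fastforce
  from 2(1)[OF z] 2(2-) z show ?case by fastforce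
next
  case (3 p a \<alpha> b \<beta>)
  show ?case
  proof (cases "a + p < b")
    case True
    obtain \<mu>' js' where z: "zmerge (Suc p) (a # \<alpha>) \<beta> = (\<mu>', js')" by fastforce
    from 3(1)[OF True z] 3(3-) z True show ?thesis by fastforce
  next
    case False
    obtain \<mu>' js' where z: "zmerge (Suc p) \<alpha> (b # \<beta>) = (\<mu>', js')" by fastforce
    from 3(2)[OF False z] 3(3-) z False show ?thesis by fastforce
  qed
qed

text \<open>Insertion at index \<open>j\<close> splits \<open>b\<close> into \<open>b - j\<close>
  and \<open>j\<close>, which preserves the total. Extraction retraces every choice because an index
  is recorded exactly when a part of \<open>\<beta>\<close> is inserted.\<close>

lemma zmerge_in_ztarget:
  assumes "zmerge p \<alpha> \<beta> = (\<mu>, js)" "(\<alpha>, \<beta>) \<in> zsource p s t"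
  shows "(\<mu>, js) \<in> ztarget p s t \<and> zsplit p \<mu> js = (\<alpha>, \<beta>) \<and>
    sum_list \<alpha> + sum_list \<beta> = sum_list \<mu> + sum_list js"
  using assms
proof (induction p \<alpha> \<beta> arbitrary: \<mu> js s t rule: zmerge.induct)
  case (1 p \<alpha>)
  then show ?case by (auto simp: zsource_def ztarget_def)
next
  case (2 p b \<beta>)
  obtain \<mu>' js' where z: "zmerge (Suc p) [] \<beta> = (\<mu>', js')" by fastforce
  have src: "([], \<beta>) \<in> zsource (Suc p) 0 (length \<beta>)" using 2(3) by (auto simp: zsource_def)
  have *: "\<mu> = (b - p) # \<mu>'" "js = p # js'" using 2(2) z by auto
  \<comment> \<open>Later entries have index at least \<open>Suc p\<close>, hence are at most
    \<open>b' - Suc p\<close> for some \<open>b' \<le> b\<close>.\<close>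
  have "x < b - p" if "x \<in> set \<mu>'" for x
    using zmerge_mem_bound[OF z _ that] 2(3) by (fastforce simp: zsource_def)
  with 2(1)[OF z src] 2(3) * show ?case by (auto simp: zsource_def ztarget_def Suc_le_eq)
next
  case (3 p a \<alpha> b \<beta>)
  show ?case
  proof (cases "a + p < b")
    case True
    obtain \<mu>' js' where z: "zmerge (Suc p) (a # \<alpha>) \<beta> = (\<mu>', js')" by fastforce
    have src: "(a # \<alpha>, \<beta>) \<in> zsource (Suc p) s (length \<beta>)" using 3(4) by (auto simp: zsource_def)
    have *: "\<mu> = (b - p) # \<mu>'" "js = p # js'" using 3(3) z True by auto
    have "x < b - p" if "x \<in> set \<mu>'" for x
      using zmerge_mem_bound[OF z _ that] 3(4) True by (fastforce simp: zsource_def)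
    with 3(1)[OF True z src] 3(4) * True show ?thesis by (auto simp: zsource_def ztarget_def Suc_le_eq)
  next
    case False
    obtain \<mu>' js' where z: "zmerge (Suc p) \<alpha> (b # \<beta>) = (\<mu>', js')" by fastforce
    have src: "(\<alpha>, b # \<beta>) \<in> zsource (Suc p) (length \<alpha>) t" using 3(4) by (auto simp: zsource_def)
    have *: "\<mu> = a # \<mu>'" "js = js'" using 3(3) z False by auto
    \<comment> \<open>If \<open>x\<close> stems from a part \<open>b'\<close> of
      \<open>b # \<beta>\<close>, the failed test gives
      \<open>x + Suc p \<le> b' \<le> b \<le> a + p\<close>.\<close>
    have lt: "x < a" if "x \<in> set \<mu>'" for x
      using zmerge_mem_bound[OF z _ that] 3(4) False by (fastforce simp: zsource_def)
    note IH = 3(2)[OF False z src]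
    \<comment> \<open>Since \<open>b\<close> is still pending, some index is recorded later, and it
      is at least \<open>Suc p\<close>; so \<open>zsplit\<close> passes over position
      \<open>p\<close>.\<close>
    obtain j js'' where js: "js' = j # js''" using IH 3(4)
      by (cases js') (auto simp: zsource_def ztarget_def)
    have "j \<noteq> p" using IH js by (auto simp: ztarget_def)
    with IH lt 3(4) * js show ?thesis by (auto simp: zsource_def ztarget_def Suc_le_eq)
  qed
qed

section \<open>Extraction is inverted by insertion\<close>

lemma length_le_hd_strict_desc:
  assumes "sorted_wrt (>) (x # xs)"
  shows "length xs \<le> (x::nat)"
  using assms
proof (induction xs arbitrary: x)
  case (Cons y ys)
  then have "length ys \<le> y" "y < x" by auto
  then show ?case by simp
qed simp

text \<open>One step to the right raises the index by one and lowers the entry by at least one, so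
  entry plus index never increases. Here \<open>x\<close> stands just before index
  \<open>p\<close>.\<close>

lemma zsplit_mem_bound:
  assumes "zsplit p \<mu> js = (\<alpha>, \<beta>)" "sorted_wrt (>) (x # \<mu>)"
  shows "(\<forall>a\<in>set \<alpha>. a < x) \<and> (\<forall>b\<in>set \<beta>. b < x + p)"
  using assms
proof (induction p \<mu> js arbitrary: \<alpha> \<beta> x rule: zsplit.induct)
  case (3 p y \<mu> j js)
  show ?case
  proof (cases "j = p")
    case True
    obtain \<alpha>' \<beta>' where z: "zsplit (Suc p) \<mu> js = (\<alpha>', \<beta>')" by fastforce
    have "sorted_wrt (>) (y # \<mu>)" using 3(4) by simp
    from 3(1)[OF True z this] 3(3,4) z True show ?thesis by fastforce
  next
    case False
    obtain \<alpha>' \<beta>' where z: "zsplit (Suc p) \<mu> (j # js) = (\<alpha>', \<beta>')" by fastforce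
    have "sorted_wrt (>) (y # \<mu>)" using 3(4) by simp
    from 3(2)[OF False z this] 3(3,4) z False show ?thesis by fastforce
  qed
qed auto

text \<open>Unites the two inserting clauses of \<open>zmerge\<close>, which saves a case split on
  \<open>\<alpha>\<close> when the test is known to succeed.\<close>

lemma zmerge_Cons_less:
  assumes "\<forall>a\<in>set \<alpha>. a + p < b"
  shows "zmerge p \<alpha> (b # \<beta>) = (case zmerge (Suc p) \<alpha> \<beta> of (\<mu>, js) \<Rightarrow> ((b - p) # \<mu>, p # js))"
  using assms by (cases \<alpha>) auto

lemma strict_asc_Cons_length_bound:
  assumes "sorted_wrt (<) (j # js)" "\<forall>i\<in>set (j # js). i < (N::nat)"
  shows "j + length js < N"
  using assms
proof (induction js arbitrary: j)
  case (Cons i js)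
  then have "i + length js < N" "j < i" by auto
  then show ?case by simp
qed simp

lemma zsplit_in_zsource:
  assumes "zsplit p \<mu> js = (\<alpha>, \<beta>)" "(\<mu>, js) \<in> ztarget p s t"
  shows "(\<alpha>, \<beta>) \<in> zsource p s t \<and> zmerge p \<alpha> \<beta> = (\<mu>, js)"
  using assms
proof (induction p \<mu> js arbitrary: \<alpha> \<beta> s t rule: zsplit.induct)
  case (1 p \<mu>)
  then show ?case by (auto simp: zsource_def ztarget_def)
next
  case (2 p j js)
  then show ?case by (auto simp: ztarget_def)
next
  case (3 p x \<mu> j js)
  have desc: "sorted_wrt (>) (x # \<mu>)" and len: "length \<mu> = s + length js" "t = Suc (length js)"
    using 3(4) by (auto simp: ztarget_def)
  \<comment> \<open>The \<open>s + t - 1\<close> entries after \<open>x\<close> are smaller, so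
    \<open>x + p\<close> meets the lower bound for parts of \<open>\<beta>\<close>.\<close>
  have x: "s + length js \<le> x" using length_le_hd_strict_desc[OF desc] len by simp
  show ?case
  proof (cases "j = p")
    case True
    obtain \<alpha>' \<beta>' where z: "zsplit (Suc p) \<mu> js = (\<alpha>', \<beta>')" by fastforce
    have tgt: "(\<mu>, js) \<in> ztarget (Suc p) s (length js)"
      using 3(4) True by (auto simp: ztarget_def Suc_le_eq)
    have *: "\<alpha> = \<alpha>'" "\<beta> = (x + p) # \<beta>'" using 3(3) z True by auto
    have b: "\<forall>a\<in>set \<alpha>'. a < x" "\<forall>b\<in>set \<beta>'. b \<le> x + p"
      using zsplit_mem_bound[OF z desc] by fastforce+
    note IH = 3(1)[OF True z tgt]
    then have "zmerge p \<alpha> \<beta> = (x # \<mu>, p # js)" using b * by (simp add: zmerge_Cons_less)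
    with IH b * x len True show ?thesis by (auto simp: zsource_def)
  next
    case False
    obtain \<alpha>' \<beta>' where z: "zsplit (Suc p) \<mu> (j # js) = (\<alpha>', \<beta>')" by fastforce
    \<comment> \<open>If \<open>p\<close> is not recorded, \<open>t\<close> distinct indices lie
      strictly between \<open>p\<close> and \<open>p + s + t\<close>, which requires
      \<open>s > 0\<close>.\<close>
    have "j + length js < p + s + t" 
      using strict_asc_Cons_length_bound[of j js] 3(4) by (auto simp: ztarget_def)
    moreover have "p < j" using False 3(4) by (auto simp: ztarget_def)
    ultimately obtain s' where s': "s = Suc s'" using len by (cases s) auto
    have "\<forall>i\<in>set (j # js). Suc p \<le> i \<and> i < p + s + t"
      using 3(4) \<open>p < j\<close> by (fastforce simp: ztarget_def)
    then have tgt: "(\<mu>, j # js) \<in> ztarget (Suc p) s' t"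
      using 3(4) s' by (auto simp: ztarget_def)
    have *: "\<alpha> = x # \<alpha>'" "\<beta> = \<beta>'" using 3(3) z False by auto
    have b: "\<forall>a\<in>set \<alpha>'. a < x" "\<forall>b\<in>set \<beta>'. b \<le> x + p"
      using zsplit_mem_bound[OF z desc] by fastforce+
    note IH = 3(2)[OF False z tgt]
    \<comment> \<open>The next part satisfies \<open>b0 \<le> x + p\<close>, so the test in
      \<open>zmerge\<close> fails and \<open>x\<close> is put back first.\<close>
    obtain b0 \<beta>0 where "\<beta>' = b0 # \<beta>0" using IH len by (cases \<beta>') (auto simp: zsource_def)
    with IH b * s' show ?thesis by (auto simp: zsource_def)
  qed
qed

lemma bij_betw_zmerge:
  "bij_betw (\<lambda>(\<alpha>, \<beta>). zmerge p \<alpha> \<beta>) (zsource p s t) (ztarget p s t)"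
proof (rule bij_betw_byWitness[where f' = "\<lambda>(\<mu>, js). zsplit p \<mu> js"])
  show "\<forall>x\<in>zsource p s t. (\<lambda>(\<mu>, js). zsplit p \<mu> js) ((\<lambda>(\<alpha>, \<beta>). zmerge p \<alpha> \<beta>) x) = x"
    using zmerge_in_ztarget by (auto split: prod.splits)
  show "\<forall>y\<in>ztarget p s t. (\<lambda>(\<alpha>, \<beta>). zmerge p \<alpha> \<beta>) ((\<lambda>(\<mu>, js). zsplit p \<mu> js) y) = y"
    using zsplit_in_zsource by (auto split: prod.splits)
  show "(\<lambda>(\<alpha>, \<beta>). zmerge p \<alpha> \<beta>) ` zsource p s t \<subseteq> ztarget p s t"
  proof (rule image_subsetI)
    fix q assume "q \<in> zsource p s t"
    then show "(\<lambda>(\<alpha>, \<beta>). zmerge p \<alpha> \<beta>) q \<in> ztarget p s t"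
      using zmerge_in_ztarget[of p "fst q" "snd q" "fst (zmerge p (fst q) (snd q))"
          "snd (zmerge p (fst q) (snd q))" s t]
      by (simp add: case_prod_beta)
  qed
  show "(\<lambda>(\<mu>, js). zsplit p \<mu> js) ` ztarget p s t \<subseteq> zsource p s t"
  proof (rule image_subsetI)
    fix q assume "q \<in> ztarget p s t"
    then show "(\<lambda>(\<mu>, js). zsplit p \<mu> js) q \<in> zsource p s t"
      using zsplit_in_zsource[of p "fst q" "snd q" "fst (zsplit p (fst q) (snd q))"
          "snd (zsplit p (fst q) (snd q))" s t]
      by (simp add: case_prod_beta)
  qed
qed

section \<open>Reduction to \<open>m = 0\<close> on both sides\<close>

lemma strict_desc_iff: "sorted_wrt (>) xs \<longleftrightarrow> is_partition xs \<and> distinct (xs :: nat list)"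
  unfolding is_partition_def by (induction xs) (auto simp: less_le)

lemma bij_betw_source_pairs_zsource:
  "bij_betw (\<lambda>(\<alpha>, \<beta>). (map (\<lambda>x. x - m) \<alpha>, \<beta>)) (source_pairs s t k m) (zsource k s t)"
proof (rule bij_betw_byWitness[where f' = "\<lambda>(\<alpha>, \<beta>). (map (\<lambda>x. x + m) \<alpha>, \<beta>)"])
  have mono: "sorted_wrt (\<lambda>x y. y - m < x - m) xs" if "sorted_wrt (>) xs" "\<forall>x\<in>set xs. m \<le> x" for xs
    using that by (induction xs) (auto simp: diff_less_mono)
  show "\<forall>x\<in>source_pairs s t k m.
      (\<lambda>(\<alpha>, \<beta>). (map (\<lambda>x. x + m) \<alpha>, \<beta>)) ((\<lambda>(\<alpha>, \<beta>). (map (\<lambda>x. x - m) \<alpha>, \<beta>)) x) = x"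
    by (auto simp: source_pairs_def intro: map_idI)
  show "\<forall>y\<in>zsource k s t.
      (\<lambda>(\<alpha>, \<beta>). (map (\<lambda>x. x - m) \<alpha>, \<beta>)) ((\<lambda>(\<alpha>, \<beta>). (map (\<lambda>x. x + m) \<alpha>, \<beta>)) y) = y"
    by (auto simp: o_def)
  have source: "source_pairs s t k m = {(\<alpha>, \<beta>). sorted_wrt (>) \<alpha> \<and> length \<alpha> = s \<and>
      (\<forall>a\<in>set \<alpha>. m \<le> a) \<and> sorted_wrt (\<ge>) \<beta> \<and> length \<beta> = t \<and>
      (\<forall>b\<in>set \<beta>. k + s + t \<le> Suc b)}"
    unfolding source_pairs_def strict_desc_iff
    by (auto simp: is_partition_def)
  show "(\<lambda>(\<alpha>, \<beta>). (map (\<lambda>x. x - m) \<alpha>, \<beta>)) ` source_pairs s t k m \<subseteq> zsource k s t"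
    using mono by (auto simp: source zsource_def sorted_wrt_map)
  show "(\<lambda>(\<alpha>, \<beta>). (map (\<lambda>x. x + m) \<alpha>, \<beta>)) ` zsource k s t \<subseteq> source_pairs s t k m"
    by (auto simp: source zsource_def sorted_wrt_map)
qed

text \<open>The amount \<open>s * m\<close> taken from \<open>\<alpha>\<close> is returned to the
  first \<open>s\<close> positions of \<open>\<mu>\<close>, wherever the parts of
  \<open>\<alpha>\<close> have ended up. This opens the gap of \<open>m + 1\<close> after position
  \<open>s\<close>.\<close>

definition raise_first :: "nat \<Rightarrow> nat \<Rightarrow> nat list \<Rightarrow> nat list" where
  "raise_first s m \<mu> = map (\<lambda>x. x + m) (take s \<mu>) @ drop s \<mu>"

definition lower_first :: "nat \<Rightarrow> nat \<Rightarrow> nat list \<Rightarrow> nat list" where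
  "lower_first s m \<mu> = map (\<lambda>x. x - m) (take s \<mu>) @ drop s \<mu>"

lemma lower_raise_first: "s \<le> length \<mu> \<Longrightarrow> lower_first s m (raise_first s m \<mu>) = \<mu>"
  by (simp add: lower_first_def raise_first_def o_def)

lemma nth_raise_first:
  "i < length \<mu> \<Longrightarrow> raise_first s m \<mu> ! i = (if i < s then \<mu> ! i + m else \<mu> ! i)"
  by (auto simp: raise_first_def nth_append min_def)

lemma nth_lower_first:
  "i < length \<mu> \<Longrightarrow> lower_first s m \<mu> ! i = (if i < s then \<mu> ! i - m else \<mu> ! i)"
  by (auto simp: lower_first_def nth_append min_def)

lemma length_raise_first [simp]: "length (raise_first s m \<mu>) = length \<mu>"
  by (simp add: raise_first_def min_def)

lemma length_lower_first [simp]: "length (lower_first s m \<mu>) = length \<mu>"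
  by (simp add: lower_first_def min_def)

lemma strict_desc_raise_first:
  assumes "sorted_wrt (>) \<mu>"
  shows "sorted_wrt (>) (raise_first s m \<mu>)"
  unfolding sorted_wrt_iff_nth_less
proof (intro allI impI)
  fix i j assume ij: "i < j" "j < length (raise_first s m \<mu>)"
  then have "\<mu> ! j < \<mu> ! i" using assms by (simp add: sorted_wrt_iff_nth_less)
  with ij show "raise_first s m \<mu> ! j < raise_first s m \<mu> ! i" by (simp add: nth_raise_first)
qed

lemma sum_list_map_add_const:
  "sum_list (map (\<lambda>x. x + m) xs) = sum_list xs + length xs * (m :: nat)"
  by (induction xs) auto

lemma sum_list_raise_first:
  assumes "s \<le> length \<mu>"
  shows "sum_list (raise_first s m \<mu>) = sum_list \<mu> + s * m"
proof -
  have "sum_list \<mu> = sum_list (take s \<mu>) + sum_list (drop s \<mu>)"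
    by (simp only: sum_list_append[symmetric] append_take_drop_id)
  with assms show ?thesis
    by (simp add: raise_first_def sum_list_map_add_const)
qed

text \<open>By monotonicity the gap between the adjacent positions \<open>s - 1\<close> and
  \<open>s\<close> extends to all pairs straddling it.\<close>

lemma gap_above:
  assumes "sorted_wrt (>) \<mu>" "0 < s" "s < length \<mu>" "\<mu> ! (s - 1) \<ge> \<mu> ! s + (m + 1)"
    "i < s" "s \<le> j" "j < length \<mu>"
  shows "\<mu> ! j + m < (\<mu> ! i :: nat)"
proof -
  have "\<mu> ! (s - 1) \<le> \<mu> ! i" using assms(1-3,5)
    by (cases "i = s - 1") (auto simp: sorted_wrt_iff_nth_less intro!: less_imp_le)
  moreover have "\<mu> ! j \<le> \<mu> ! s" using assms(1,6,7)
    by (cases "j = s") (auto simp: sorted_wrt_iff_nth_less intro!: less_imp_le)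
  ultimately show ?thesis using assms(4) by linarith
qed

lemma strict_desc_lower_first:
  assumes "sorted_wrt (>) \<mu>" "0 < s" "s < length \<mu>" "\<mu> ! (s - 1) \<ge> \<mu> ! s + (m + 1)"
  shows "sorted_wrt (>) (lower_first s m \<mu>)" "raise_first s m (lower_first s m \<mu>) = \<mu>"
proof -
  \<comment> \<open>The gap makes the subtraction of \<open>m\<close> exact on the first
    \<open>s\<close> entries.\<close>
  have ge: "m \<le> \<mu> ! i" if "i < s" for i
    using gap_above[OF assms that, of s] assms(3) by simp
  have "lower_first s m \<mu> ! j < lower_first s m \<mu> ! i" if "i < j" "j < length \<mu>" for i j
  proof -
    have "\<mu> ! j < \<mu> ! i" using assms(1) that by (simp add: sorted_wrt_iff_nth_less)
    \<comment> \<open>Only a straddling pair has its difference reduced by the lowering.\<close>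
    moreover have "\<mu> ! j + m < \<mu> ! i" if "i < s" "\<not> j < s"
      using gap_above[OF assms, of i j] that \<open>j < length \<mu>\<close> by simp
    ultimately show ?thesis using that ge[of j]
      by (auto simp: nth_lower_first diff_less_mono)
  qed
  then show "sorted_wrt (>) (lower_first s m \<mu>)" by (simp add: sorted_wrt_iff_nth_less)
  show "raise_first s m (lower_first s m \<mu>) = \<mu>"
    by (rule nth_equalityI) (auto simp: nth_raise_first nth_lower_first ge)
qed

lemma bij_betw_ztarget_target_pairs:
  assumes "0 < s" "0 < t"
  shows "bij_betw (\<lambda>(\<mu>, js). (raise_first s m \<mu>, rev js)) (ztarget k s t) (target_pairs s t k m)"
proof (rule bij_betw_byWitness[where f' = "\<lambda>(\<mu>, \<nu>). (lower_first s m \<mu>, rev \<nu>)"])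
  \<comment> \<open>Positivity selects the first branch of \<open>target_pairs\<close> and turns
    \<open>x \<le> k + s + t - 1\<close> into a strict bound.\<close>
  have target: "target_pairs s t k m = {(\<mu>, \<nu>). sorted_wrt (>) \<mu> \<and> length \<mu> = s + t \<and>
      \<mu> ! (s - 1) \<ge> \<mu> ! s + (m + 1) \<and> sorted_wrt (>) \<nu> \<and> length \<nu> = t \<and>
      (\<forall>x\<in>set \<nu>. k \<le> x \<and> x < k + s + t)}"
    using assms unfolding target_pairs_def strict_desc_iff by fastforce
  show "\<forall>x\<in>ztarget k s t. (\<lambda>(\<mu>, \<nu>). (lower_first s m \<mu>, rev \<nu>))
      ((\<lambda>(\<mu>, js). (raise_first s m \<mu>, rev js)) x) = x"
    by (auto simp: ztarget_def lower_raise_first)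
  show "\<forall>y\<in>target_pairs s t k m. (\<lambda>(\<mu>, js). (raise_first s m \<mu>, rev js))
      ((\<lambda>(\<mu>, \<nu>). (lower_first s m \<mu>, rev \<nu>)) y) = y"
    using assms strict_desc_lower_first(2) by (auto simp: target)
  have gap: "raise_first s m \<mu> ! s + m < raise_first s m \<mu> ! (s - 1)"
    if "sorted_wrt (>) \<mu>" "length \<mu> = s + t" for \<mu>
    using that assms by (auto simp: sorted_wrt_iff_nth_less nth_raise_first)
  show "(\<lambda>(\<mu>, js). (raise_first s m \<mu>, rev js)) ` ztarget k s t \<subseteq> target_pairs s t k m"
    using gap by (auto simp: target ztarget_def strict_desc_raise_first sorted_wrt_rev Suc_le_eq)
  show "(\<lambda>(\<mu>, \<nu>). (lower_first s m \<mu>, rev \<nu>)) ` target_pairs s t k m \<subseteq> ztarget k s t"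
    using assms by (auto simp: target ztarget_def strict_desc_lower_first(1) sorted_wrt_rev)
qed

section \<open>The bijection for all \<open>s\<close> and \<open>t\<close>\<close>

definition insertion :: "nat \<Rightarrow> nat \<Rightarrow> nat \<Rightarrow> nat list \<times> nat list \<Rightarrow> nat list \<times> nat list" where
  "insertion s k m = (\<lambda>(\<mu>, js). (raise_first s m \<mu>, rev js)) \<circ> (\<lambda>(\<alpha>, \<beta>). zmerge k \<alpha> \<beta>) \<circ>
     (\<lambda>(\<alpha>, \<beta>). (map (\<lambda>x. x - m) \<alpha>, \<beta>))"

text \<open>With no part of \<open>\<alpha>\<close> left to compare, the parts of
  \<open>\<beta>\<close> go in at consecutive indices.\<close>

lemma zmerge_Nil:
  "zmerge p [] \<beta> = (map (\<lambda>i. \<beta> ! i - p - i) [0..<length \<beta>], [p..<p + length \<beta>])"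
proof (induction \<beta> arbitrary: p)
  case (Cons b \<beta>)
  have "map (\<lambda>i. (b # \<beta>) ! i - p - i) [0..<length (b # \<beta>)] =
      (b - p) # map (\<lambda>i. \<beta> ! i - Suc p - i) [0..<length \<beta>]"
    by (rule nth_equalityI) (auto simp: nth_Cons' simp del: upt_Suc)
  with Cons show ?case by (simp add: upt_conv_Cons del: upt_Suc)
qed simp

text \<open>For \<open>t = 0\<close> nothing is inserted, and raising all \<open>s\<close> parts
  undoes the lowering by \<open>m\<close>. For \<open>s = 0\<close> nothing is raised, and all
  indices from \<open>k\<close> to \<open>k + t - 1\<close> are recorded.\<close>

lemma insertion_degenerate:
  assumes "s = 0 \<or> t = 0" "q \<in> source_pairs s t k m"
  shows "insertion s k m q = degenerate_map s t k q"
proof -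
  obtain \<alpha> \<beta> where q: "q = (\<alpha>, \<beta>)" by fastforce
  have len: "length \<alpha> = s" "length \<beta> = t" and ge: "\<forall>a\<in>set \<alpha>. m \<le> a"
    using assms(2) q by (auto simp: source_pairs_def)
  show ?thesis
  proof (cases "t = 0")
    case True
    have "map (\<lambda>x. x - m + m) \<alpha> = \<alpha>" using ge by (auto intro: map_idI)
    with True len q show ?thesis
      by (auto simp: insertion_def degenerate_map_def raise_first_def o_def)
  next
    case False
    have "rev [k..<k + t] = map (\<lambda>i. k + t - 1 - i) [0..<t]"
      by (rule nth_equalityI) (auto simp: rev_nth)
    with False assms(1) len q show ?thesis
      by (auto simp: insertion_def degenerate_map_def raise_first_def zmerge_Nil)
  qed
qed

text \<open>Lowering \<open>\<alpha>\<close> and raising \<open>\<mu>\<close> change the sums by the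
  same \<open>s * m\<close>, so the total is preserved as in the normalised case.\<close>

lemma insertion_partitions:
  assumes "q \<in> source_pairs s t k m" "insertion s k m q = (\<mu>, \<nu>)"
  shows "is_partition \<mu>" "is_partition \<nu>" "sum_list (fst q) + sum_list (snd q) = sum_list \<mu> + sum_list \<nu>"
proof -
  obtain \<alpha> \<beta> where q: "q = (\<alpha>, \<beta>)" by fastforce
  obtain \<mu>' js where z: "zmerge k (map (\<lambda>x. x - m) \<alpha>) \<beta> = (\<mu>', js)" by fastforce
  have eq: "\<mu> = raise_first s m \<mu>'" "\<nu> = rev js"
    using assms(2) q z by (auto simp: insertion_def)
  have "(map (\<lambda>x. x - m) \<alpha>, \<beta>) \<in> zsource k s t"
    using bspec[OF bij_betwE[OF bij_betw_source_pairs_zsource] assms(1)] q by simp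
  note * = zmerge_in_ztarget[OF z this]
  show "is_partition \<mu>" "is_partition \<nu>"
    using * strict_desc_raise_first[of \<mu>' s m] strict_desc_iff[of \<mu>] strict_desc_iff[of \<nu>]
    by (auto simp: eq ztarget_def sorted_wrt_rev)
  have len: "length \<alpha> = s" and ge: "\<forall>a\<in>set \<alpha>. m \<le> a"
    using assms(1) q by (auto simp: source_pairs_def)
  have "sum_list (map (\<lambda>x. x - m + m) \<alpha>) = sum_list (map (\<lambda>x. x - m) \<alpha>) + s * m"
    using sum_list_map_add_const[of m "map (\<lambda>x. x - m) \<alpha>"] len by (simp add: o_def)
  moreover have "map (\<lambda>x. x - m + m) \<alpha> = \<alpha>" using ge by (auto intro: map_idI)
  moreover have "sum_list \<mu> = sum_list \<mu>' + s * m"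
    using * by (simp add: eq ztarget_def sum_list_raise_first)
  ultimately show "sum_list (fst q) + sum_list (snd q) = sum_list \<mu> + sum_list \<nu>"
    using * by (simp add: eq q sum_list_rev)
qed

lemma bij_betw_insertion:
  "bij_betw (insertion s k m) (source_pairs s t k m) (target_pairs s t k m)"
proof -
  have zbij: "bij_betw ((\<lambda>(\<alpha>, \<beta>). zmerge k \<alpha> \<beta>) \<circ> (\<lambda>(\<alpha>, \<beta>). (map (\<lambda>x. x - m) \<alpha>, \<beta>)))
      (source_pairs s t k m) (ztarget k s t)"
    by (rule bij_betw_trans[OF bij_betw_source_pairs_zsource bij_betw_zmerge])
  show ?thesis
  proof (cases "0 < s \<and> 0 < t")
    case True
    then have "bij_betw (\<lambda>(\<mu>, js). (raise_first s m \<mu>, rev js)) (ztarget k s t) (target_pairs s t k m)"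
      by (simp add: bij_betw_ztarget_target_pairs)
    with zbij show ?thesis
      unfolding insertion_def comp_assoc by (rule bij_betw_trans)
  next
    case False
    \<comment> \<open>Only injectivity calls for an argument here, since the degenerate target is
      defined through an image; \<open>lower_first\<close> serves as left inverse.\<close>
    have "inj_on (\<lambda>(\<mu>, js). (raise_first s m \<mu>, rev js)) (ztarget k s t)"
      by (rule inj_on_inverseI[where g = "\<lambda>(\<mu>, \<nu>). (lower_first s m \<mu>, rev \<nu>)"])
        (auto simp: ztarget_def lower_raise_first)
    then have inj: "inj_on (insertion s k m) (source_pairs s t k m)"
      unfolding insertion_def comp_assoc
      by (intro comp_inj_on[OF bij_betw_imp_inj_on[OF zbij]])
        (simp only: bij_betw_imp_surj_on[OF zbij])
    have img: "degenerate_map s t k ` source_pairs s t k m = insertion s k m ` source_pairs s t k m"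
      using False by (intro image_cong refl insertion_degenerate[symmetric]) auto
    \<comment> \<open>The partition conditions in \<open>target_pairs\<close> thus cut nothing from
      this image.\<close>
    have "is_partition \<mu> \<and> is_partition \<nu>"
      if "(\<mu>, \<nu>) \<in> insertion s k m ` source_pairs s t k m" for \<mu> \<nu>
      using that insertion_partitions(1,2) by (metis imageE)
    then have "target_pairs s t k m = insertion s k m ` source_pairs s t k m"
      using False unfolding target_pairs_def img by auto
    with inj show ?thesis by (simp add: bij_betw_def)
  qed
qed

theorem theorem3p1:
  fixes s t k m :: nat
  shows "\<exists>\<phi> :: nat list \<times> nat list \<Rightarrow> nat list \<times> nat list.
    bij_betw \<phi> (source_pairs s t k m) (target_pairs s t k m) \<and>
    (s = 0 \<or> t = 0 \<longrightarrow> (\<forall>p\<in>source_pairs s t k m. \<phi> p = degenerate_map s t k p)) \<and>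
    (\<forall>\<alpha> \<beta> \<mu> \<nu>. (\<alpha>, \<beta>) \<in> source_pairs s t k m \<longrightarrow> \<phi> (\<alpha>, \<beta>) = (\<mu>, \<nu>) \<longrightarrow>
      sum_list \<alpha> + sum_list \<beta> = sum_list \<mu> + sum_list \<nu>)"
proof (intro exI[of _ "insertion s k m"] conjI allI impI ballI)
  show "bij_betw (insertion s k m) (source_pairs s t k m) (target_pairs s t k m)"
    by (rule bij_betw_insertion)
  show "insertion s k m p = degenerate_map s t k p"
    if "s = 0 \<or> t = 0" "p \<in> source_pairs s t k m" for p
    using that by (rule insertion_degenerate)
  show "sum_list \<alpha> + sum_list \<beta> = sum_list \<mu> + sum_list \<nu>"
    if "(\<alpha>, \<beta>) \<in> source_pairs s t k m" "insertion s k m (\<alpha>, \<beta>) = (\<mu>, \<nu>)" for \<alpha> \<beta> \<mu> \<nu>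
    using insertion_partitions(3)[OF that] by simp
qed

end
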